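(* Fix a constant step-size $\alpha$ satisfying $$0<\alpha<\min\left\{\frac{2\delta}{\tau}\Big(\frac{\mu}{2\rho}\Big)^{\frac{2\delta-1}{\delta(1+\nu)-1}},\ \frac{\tau}{(\tau^{2\delta}+1)^{\frac1{2\delta}}}\Big(\frac{\mu}{2\rho}\Big)^{\frac{1}{\delta(1+\nu)-1}},\ 1\right\}.$$ Let $\{x_k\}_{k\ge0}$ be generated by the projected subgradient method with initial point $x_0\in\mathcal{T}_{1/2}$ and constant step-size $\alpha_k=\alpha$, and let $D_k:=\operatorname{dist}^2(x_k;\mathcal{X}^* )$. Define the constants $$D_*:=\Big(\frac{\alpha}{\tau}\Big)^{2\delta},\qquad q:=1-\frac{\alpha\tau}{2\delta}\Big(\frac{2\rho}{\mu}\Big)^{\frac{2\delta-1}{\delta(1+\nu)-1}},\qquad \mathcal{D}^2:=\max\{D_0,\ \alpha^2+D_*\}\quad(\mathcal{D}\ge0).$$ Then $0<q<1$, and for any $k\in\mathbb{N}$, $$\sqrt{D_k}\le\mathcal{D}\le\Big(\frac{\mu}{2\rho}\Big)^{\frac{\delta}{\delta(1+\nu)-1}}\qquad\text{and}\qquad D_k-D_*\le\max\left\{q^k(D_0-D_* ),\ \alpha^2\right\}.$$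
   Context: $\|\cdot\|$ is the Euclidean norm on $\mathbb{R}^n$, $\operatorname{dist}(x;S)=\inf_{z\in S}\|z-x\|$, $\operatorname{proj}_X$ is the Euclidean projection onto $X$, $\operatorname{dom}(f)=\{x:f(x)<+\infty\}$, and $\partial f$ is the Clarke subdifferential. Standing assumptions: $f:\mathbb{R}^n\to\mathbb{R}\cup\{+\infty\}$ is proper; $X\subseteq\operatorname{dom}(f)$ is nonempty, closed and convex; the set of minimizers $\mathcal{X}^*=\operatorname{argmin}_{x\in X}f(x)$ is nonempty and $f^*$ is the minimal value of $f$ over $X$. The parameters satisfy $\rho>0$, $0<\nu\le1$, $\frac1{1+\nu}<\delta\le1$, $\mu>0$, and: (i) $f$ is $\nu$-paraconvex with constant $\rho$ on an open convex set $X'$ with $X\subseteq X'\subseteq\operatorname{dom}(f)$, i.e. $f(\lambda x+(1-\lambda)y)\le\lambda f(x)+(1-\lambda)f(y)+\rho\min\{\lambda,1-\lambda\}\|x-y\|^{1+\nu}$ for all $x,y\in X'$, $\lambda\in[0,1]$ (consequently $f$ is locally Lipschitz on $X'$); (ii) Hölderian error bound: $\mu\operatorname{dist}^{1/\delta}(x;\mathcal{X}^* )\le f(x)-f^*$ for all $x\in X$. For $\gamma\in(0,1]$ let $\mathcal{T}_\gamma=\big\{x\in X:\operatorname{dist}(x;\mathcal{X}^* )<(\gamma\mu/\rho)^{\delta/(\delta(1+\nu)-1)}\big\}$. Let $L=\sup\{\|\zeta\|:\zeta\in\partial f(x),\ x\in\mathcal{T}_1\}$, with $0<L<\infty$, and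 $\tau=\mu/L$. Projected subgradient method with step-sizes $\alpha_k$: from the initial point, at each iteration choose any $\zeta_k\in\partial f(x_k)$ and set $x_{k+1}=\operatorname{proj}_X\big(x_k-\alpha_k\zeta_k/\|\zeta_k\|\big)$; if $\zeta_k=0$, set $x_{k+1}=x_k$. *)

theory Defs
  imports "HOL-Analysis.Analysis"
begin

text \<open>Extended-real-valued functions \<open>f\<close> model maps into the reals with \<open>+\<infinity>\<close> adjoined;
  the value \<open>-\<infinity>\<close> is excluded by \<open>proper_fun\<close>.\<close>

definition effective_dom :: "('a \<Rightarrow> ereal) \<Rightarrow> 'a set" where
  "effective_dom f = {x. f x < \<infinity>}"

definition proper_fun :: "('a \<Rightarrow> ereal) \<Rightarrow> bool" where
  "proper_fun f \<longleftrightarrow> (\<forall>x. f x \<noteq> -\<infinity>) \<and> effective_dom f \<noteq> {}"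

definition minimizers :: "('a \<Rightarrow> ereal) \<Rightarrow> 'a set \<Rightarrow> 'a set" where
  "minimizers f X = {x. is_arg_min f (\<lambda>y. y \<in> X) x}"

definition paraconvex_on :: "('a::real_normed_vector) set \<Rightarrow> real \<Rightarrow> real \<Rightarrow> ('a \<Rightarrow> ereal) \<Rightarrow> bool" where
  "paraconvex_on S \<nu> \<rho> f \<longleftrightarrow>
     (\<forall>x\<in>S. \<forall>y\<in>S. \<forall>l\<in>{0..1}.
        f (l *\<^sub>R x + (1 - l) *\<^sub>R y)
          \<le> ereal l * f x + ereal (1 - l) * f y
             + ereal (\<rho> * min l (1 - l) * norm (x - y) powr (1 + \<nu>)))"

text \<open>Clarke's generalized directional derivative: the upper limit of the difference quotients as
  the base point \<open>y\<close> tends to \<open>x\<close> (\<open>y = x\<close> allowed) and \<open>t\<close> decreases to 0. The subdifferential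
  below is Clarke's definition for functions that are finite and locally Lipschitz near \<open>x\<close>; it is
  not meant to be used at other points.\<close>

definition clarke_dderiv :: "('a::real_normed_vector \<Rightarrow> ereal) \<Rightarrow> 'a \<Rightarrow> 'a \<Rightarrow> ereal" where
  "clarke_dderiv f x d =
     Limsup (nhds x \<times>\<^sub>F at_right 0) (\<lambda>(y, t). (f (y + t *\<^sub>R d) - f y) / ereal t)"

definition clarke_subdiff :: "('a::real_inner \<Rightarrow> ereal) \<Rightarrow> 'a \<Rightarrow> 'a set" where
  "clarke_subdiff f x = {\<zeta>. \<forall>d. ereal (\<zeta> \<bullet> d) \<le> clarke_dderiv f x d}"

definition holder_error_bound ::
  "('a::metric_space \<Rightarrow> ereal) \<Rightarrow> 'a set \<Rightarrow> real \<Rightarrow> real \<Rightarrow> bool" where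
  "holder_error_bound f X \<mu> \<delta> \<longleftrightarrow>
     (\<forall>x\<in>X. ereal (\<mu> * infdist x (minimizers f X) powr (1 / \<delta>)) \<le> f x - (INF y\<in>X. f y))"

definition tube ::
  "('a::metric_space \<Rightarrow> ereal) \<Rightarrow> 'a set \<Rightarrow> real \<Rightarrow> real \<Rightarrow> real \<Rightarrow> real \<Rightarrow> real \<Rightarrow> 'a set" where
  "tube f X \<nu> \<rho> \<mu> \<delta> \<gamma> =
     {x\<in>X. infdist x (minimizers f X) < (\<gamma> * \<mu> / \<rho>) powr (\<delta> / (\<delta> * (1 + \<nu>) - 1))}"

definition proj_subgradient_seq ::
  "('a::euclidean_space \<Rightarrow> ereal) \<Rightarrow> 'a set \<Rightarrow> (nat \<Rightarrow> real) \<Rightarrow> (nat \<Rightarrow> 'a) \<Rightarrow> bool" where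
  "proj_subgradient_seq f X a x \<longleftrightarrow>
     (\<forall>k. \<exists>\<zeta>\<in>clarke_subdiff f (x k).
        x (Suc k) = (if \<zeta> = 0 then x k
                     else closest_point X (x k - a k *\<^sub>R (\<zeta> /\<^sub>R norm \<zeta>))))"

end

theory Submission
  imports Defs
begin

text \<open>Write \<open>d\<close> for the distance of an iterate to the solution set and \<open>D = d\<^sup>2\<close>. The argument turns one
  iteration into the scalar recursion \<open>D' \<le> D + \<alpha>\<^sup>2 - \<alpha> \<tau> D\<^sup>s\<close> with \<open>s = 1 / (2 \<delta>)\<close> and then analyses that
  recursion.

  Paraconvexity makes \<open>f\<close> continuous on the open set, and hence Clarke's upper limit can be evaluated
  term by term: a Clarke subgradient \<open>\<zeta>\<close> at \<open>x\<close> satisfies the subgradient inequality of convex analysis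
  up to the error \<open>\<rho> \<parallel>y - x\<parallel>\<^bsup>1+\<nu>\<^esup>\<close> (\<open>clarke_subdiff_paraconvex_inequality\<close>). Take for \<open>y\<close> a minimizer
  nearest to \<open>x\<close>. The error bound gives \<open>f x - f y \<ge> \<mu> d\<^bsup>1/\<delta>\<^esup>\<close>, and in the region
  \<open>d \<le> R = (\<mu> / (2 \<rho>))\<^bsup>\<delta>/(\<delta>(1+\<nu>)-1)\<^esup>\<close> the paraconvexity error uses up at most half of this gain. So
  \<open>\<zeta> \<bullet> (x - y) \<ge> (\<mu>/2) d\<^bsup>1/\<delta>\<^esup>\<close>, and nonexpansiveness of the projection yields the recursion
  (\<open>infdist_projected_subgradient_step\<close>).

  The value \<open>Dstar\<close> is the equilibrium of the recursion: \<open>\<alpha> \<tau> Dstar\<^sup>s = \<alpha>\<^sup>2\<close>. Above it, concavity of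
  \<open>t \<mapsto> t\<^sup>s\<close> together with \<open>D \<le> R\<^sup>2\<close> bounds \<open>D\<^sup>s - Dstar\<^sup>s\<close> from below by \<open>s R\<^bsup>2(s-1)\<^esup> (D - Dstar)\<close>, which is a
  contraction of \<open>D - Dstar\<close> with exactly the factor \<open>q\<close>. Below it, one iteration overshoots by at most
  \<open>\<alpha>\<^sup>2\<close>. The second bound on the step-size and \<open>\<alpha> < 1\<close> ensure \<open>\<alpha>\<^sup>2 + Dstar \<le> R\<^sup>2\<close>, so that the iterates never
  leave the region (\<open>sublinear_recursion_bound\<close>).\<close>

section \<open>Continuity of paraconvex functions\<close>

lemma paraconvex_on_ereal_cong:
  assumes "paraconvex_on S \<nu> \<rho> f" "convex S" "\<And>x. x \<in> S \<Longrightarrow> f x = ereal (g x)"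
  shows "paraconvex_on S \<nu> \<rho> (\<lambda>x. ereal (g x))"
  unfolding paraconvex_on_def
proof (intro ballI)
  fix x y and l :: real
  assume xy: "x \<in> S" "y \<in> S" and l: "l \<in> {0..1}"
  have "l *\<^sub>R x + (1 - l) *\<^sub>R y \<in> S"
    using \<open>convex S\<close> xy l by (auto intro: convexD)
  then show "ereal (g (l *\<^sub>R x + (1 - l) *\<^sub>R y))
      \<le> ereal l * ereal (g x) + ereal (1 - l) * ereal (g y)
        + ereal (\<rho> * min l (1 - l) * norm (x - y) powr (1 + \<nu>))"
    using assms(1) xy l assms(3) unfolding paraconvex_on_def by metis
qed

text \<open>For estimates near one endpoint only the factor \<open>l\<close> of \<open>min l (1 - l)\<close> matters, since the error must
  vanish with \<open>l\<close>.\<close>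

lemma paraconvex_onD:
  fixes g :: "'a::real_normed_vector \<Rightarrow> real"
  assumes "paraconvex_on S \<nu> \<rho> (\<lambda>x. ereal (g x))" "0 \<le> \<rho>"
    and "x \<in> S" "y \<in> S" "0 \<le> l" "l \<le> 1"
  shows "g (l *\<^sub>R x + (1 - l) *\<^sub>R y)
    \<le> l * g x + (1 - l) * g y + \<rho> * l * norm (x - y) powr (1 + \<nu>)"
proof -
  have "ereal (g (l *\<^sub>R x + (1 - l) *\<^sub>R y))
      \<le> ereal l * ereal (g x) + ereal (1 - l) * ereal (g y)
        + ereal (\<rho> * min l (1 - l) * norm (x - y) powr (1 + \<nu>))"
    using assms unfolding paraconvex_on_def by auto
  then have "g (l *\<^sub>R x + (1 - l) *\<^sub>R y)
      \<le> l * g x + (1 - l) * g y + \<rho> * min l (1 - l) * norm (x - y) powr (1 + \<nu>)"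
    by simp
  moreover have "\<rho> * min l (1 - l) * norm (x - y) powr (1 + \<nu>) \<le> \<rho> * l * norm (x - y) powr (1 + \<nu>)"
    by (intro mult_right_mono mult_left_mono) (use assms in auto)
  ultimately show ?thesis by linarith
qed

text \<open>Paraconvexity bounds the value at a convex combination of two points by the larger of the two values
  plus an error controlled by their distance. Adding the points of \<open>T\<close> one at a time accumulates only
  finitely many such errors, because hulls of finite sets are bounded.\<close>

lemma paraconvex_on_bdd_above_convex_hull:
  fixes g :: "'a::real_normed_vector \<Rightarrow> real"
  assumes "paraconvex_on S \<nu> \<rho> (\<lambda>x. ereal (g x))" "0 \<le> \<rho>" "0 \<le> \<nu>" "convex S"
    and "finite T" "T \<subseteq> S"
  shows "\<exists>M. \<forall>z\<in>convex hull T. g z \<le> M"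
  using \<open>finite T\<close> \<open>T \<subseteq> S\<close>
proof (induction T rule: finite_induct)
  case (insert a T)
  show ?case
  proof (cases "T = {}")
    case False
    obtain M where M: "\<And>z. z \<in> convex hull T \<Longrightarrow> g z \<le> M"
      using insert by auto
    have "bounded ((\<lambda>b. - a + b) ` (convex hull T))"
      using insert.hyps by (intro bounded_translation finite_imp_bounded_convex_hull)
    then obtain B where B: "\<And>b. b \<in> convex hull T \<Longrightarrow> norm (a - b) \<le> B"
      unfolding bounded_iff by (auto simp: norm_minus_commute)
    have TS: "convex hull T \<subseteq> S"
      using insert.prems \<open>convex S\<close> by (intro hull_minimal) auto
    have "g z \<le> max (g a) M + \<rho> * B powr (1 + \<nu>)" if z: "z \<in> convex hull (insert a T)" for z
    proof -
      obtain u v b where uv: "u \<ge> 0" "v \<ge> 0" "u + v = 1" "b \<in> convex hull T"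
        and zeq: "z = u *\<^sub>R a + v *\<^sub>R b"
        using z unfolding convex_hull_insert[OF False] by auto
      have v: "v = 1 - u" using uv by simp
      have "g z \<le> u * g a + (1 - u) * g b + \<rho> * u * norm (a - b) powr (1 + \<nu>)"
        unfolding zeq v using uv TS insert.prems assms(1,2)
        by (intro paraconvex_onD[of S]) auto
      also have "u * g a + (1 - u) * g b \<le> max (g a) M"
        using uv M[OF uv(4)] v by (intro convex_bound_le) auto
      also have "\<rho> * u * norm (a - b) powr (1 + \<nu>) \<le> \<rho> * 1 * B powr (1 + \<nu>)"
        using uv B[OF uv(4)] assms by (intro mult_mono powr_mono2) auto
      finally show ?thesis by simp
    qed
    then show ?thesis by blast
  qed auto
qed auto

text \<open>As for convex functions, an upper bound \<open>M\<close> on a ball controls the variation around the centre in both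
  directions. Prolong the segment from \<open>x\<close> to \<open>z\<close> until it has length \<open>r\<close> on either side, with ends
  \<open>w\<close> (beyond \<open>z\<close>) and \<open>w'\<close> (opposite to \<open>z\<close>): then \<open>z\<close> lies between \<open>x\<close> and \<open>w\<close>, which bounds
  \<open>g z\<close> from above, and \<open>x\<close> lies between \<open>w'\<close> and \<open>z\<close>, which bounds it from below.\<close>

lemma paraconvex_on_Lipschitz_at:
  fixes g :: "'a::real_normed_vector \<Rightarrow> real"
  assumes para: "paraconvex_on S \<nu> \<rho> (\<lambda>x. ereal (g x))" "0 \<le> \<rho>" "0 \<le> \<nu>"
    and r: "0 < r" "cball x r \<subseteq> S"
    and M: "\<And>z. z \<in> cball x r \<Longrightarrow> g z \<le> M"
    and z: "z \<in> cball x r"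
  shows "\<bar>g z - g x\<bar> \<le> norm (z - x) / r * (M - g x + \<rho> * (2 * r) powr (1 + \<nu>))"
proof (cases "z = x")
  case False
  define t where "t = norm (z - x) / r"
  have t: "0 < t" "t \<le> 1"
    using False z r by (auto simp: t_def dist_norm norm_minus_commute)
  have nzx: "norm (z - x) = t * r" using r by (simp add: t_def)
  define w where "w = x + (1 / t) *\<^sub>R (z - x)"
  define w' where "w' = x - (1 / t) *\<^sub>R (z - x)"
  have w: "w \<in> cball x r" "w' \<in> cball x r"
    using t r nzx by (auto simp: w_def w'_def dist_norm)
  have S: "w \<in> S" "w' \<in> S" "x \<in> S" "z \<in> S" using w z r by auto
  have zeq: "z = t *\<^sub>R w + (1 - t) *\<^sub>R x"
    using t by (simp add: w_def algebra_simps)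
  have "g z \<le> t * g w + (1 - t) * g x + \<rho> * t * norm (w - x) powr (1 + \<nu>)"
    unfolding zeq using S t para by (intro paraconvex_onD[of S]) auto
  also have "t * g w \<le> t * M" using M[OF w(1)] t by simp
  also have "\<rho> * t * norm (w - x) powr (1 + \<nu>) \<le> \<rho> * t * (2 * r) powr (1 + \<nu>)"
    using w r para t by (intro mult_left_mono powr_mono2) (auto simp: dist_norm norm_minus_commute)
  finally have up: "g z - g x \<le> t * (M - g x + \<rho> * (2 * r) powr (1 + \<nu>))"
    by (simp add: algebra_simps)
  \<comment> \<open>the weight that makes \<open>x\<close> a combination of \<open>w'\<close> and \<open>z\<close>\<close>
  define l where "l = t / (1 + t)"
  have l: "0 \<le> l" "l \<le> 1" "(1 + t) * l = t" "(1 + t) * (1 - l) = 1" 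
    using t by (auto simp: l_def field_simps)
  have "(1 + t) *\<^sub>R (l *\<^sub>R w' + (1 - l) *\<^sub>R z) = t *\<^sub>R w' + z"
    by (simp only: scaleR_add_right scaleR_scaleR l) simp
  also have "\<dots> = (1 + t) *\<^sub>R x"
    using t by (simp add: w'_def algebra_simps)
  finally have xeq: "l *\<^sub>R w' + (1 - l) *\<^sub>R z = x"
    using t by simp
  have "norm (w' - z) \<le> 2 * r"
    using w(2) z norm_triangle_ineq4[of "w' - x" "z - x"] 
    by (auto simp: dist_norm norm_minus_commute)
  then have "\<rho> * l * norm (w' - z) powr (1 + \<nu>) \<le> \<rho> * l * (2 * r) powr (1 + \<nu>)"
    using para l by (intro mult_left_mono powr_mono2) auto
  moreover have "g x \<le> l * g w' + (1 - l) * g z + \<rho> * l * norm (w' - z) powr (1 + \<nu>)"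
    using paraconvex_onD[OF para(1,2) S(2,4) l(1,2)] unfolding xeq .
  moreover have "l * g w' \<le> l * M" using M[OF w(2)] l by (intro mult_left_mono) auto
  ultimately have "g x \<le> l * M + (1 - l) * g z + \<rho> * l * (2 * r) powr (1 + \<nu>)" by linarith
  then have "(1 + t) * g x \<le> (1 + t) * (l * M + (1 - l) * g z + \<rho> * l * (2 * r) powr (1 + \<nu>))"
    using t by (intro mult_left_mono) auto
  also have "\<dots> = ((1 + t) * l) * M + ((1 + t) * (1 - l)) * g z + \<rho> * ((1 + t) * l) * (2 * r) powr (1 + \<nu>)"
    by (simp only: algebra_simps)
  finally have "g x - g z \<le> t * (M - g x + \<rho> * (2 * r) powr (1 + \<nu>))"
    unfolding l by (simp add: algebra_simps)
  with up show ?thesis by (simp add: t_def abs_le_iff)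
qed auto

text \<open>Finite dimension enters here: a point has a box around it that is the convex hull of finitely many
  points, on which \<open>g\<close> is bounded above.\<close>

lemma paraconvex_on_continuous_on:
  fixes g :: "'a::euclidean_space \<Rightarrow> real"
  assumes para: "paraconvex_on S \<nu> \<rho> (\<lambda>x. ereal (g x))" "0 \<le> \<rho>" "0 \<le> \<nu>"
    and S: "open S" "convex S"
  shows "continuous_on S g"
proof (rule continuous_at_imp_continuous_on, intro ballI)
  fix x assume "x \<in> S"
  obtain a b where ab: "cbox a b \<subseteq> S" "x \<in> box a b"
    by (rule open_contains_cbox[OF S(1) \<open>x \<in> S\<close>])
  obtain T where T: "finite T" "cbox a b = convex hull T"
    by (rule closed_interval_as_convex_hull)
  have "T \<subseteq> S" using T(2) ab(1) hull_subset[of T convex] by auto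
  then obtain M where M: "\<And>z. z \<in> cbox a b \<Longrightarrow> g z \<le> M"
    using paraconvex_on_bdd_above_convex_hull[OF para S(2) T(1)] T(2) by auto
  obtain r where r: "0 < r" "cball x r \<subseteq> box a b"
    using ab(2) open_box[of a b] unfolding open_contains_cball by auto
  then have rc: "cball x r \<subseteq> cbox a b" using box_subset_cbox by blast
  define K where "K = M - g x + \<rho> * (2 * r) powr (1 + \<nu>)"
  have Lip: "\<bar>g z - g x\<bar> \<le> norm (z - x) / r * K" if "z \<in> cball x r" for z
    unfolding K_def using that r rc ab M
    by (intro paraconvex_on_Lipschitz_at[OF para]) auto
  have "\<forall>\<^sub>F z in at x. norm (g z - g x) \<le> norm (z - x) / r * K"
    using eventually_at_ball[OF r(1), of x UNIV] 
    by (rule eventually_mono) (use Lip in auto)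
  moreover have "((\<lambda>z. norm (z - x) / r * K) \<longlongrightarrow> norm (x - x) / r * K) (at x)"
    using r by (intro tendsto_intros) auto
  then have "((\<lambda>z. norm (z - x) / r * K) \<longlongrightarrow> 0) (at x)" by simp
  ultimately have "((\<lambda>z. g z - g x) \<longlongrightarrow> 0) (at x)"
    by (rule Lim_null_comparison)
  then show "isCont g x" by (simp add: isCont_def LIM_zero_iff)
qed

section \<open>The subgradient inequality\<close>

text \<open>For \<open>d = y - x\<close> and any base point \<open>z\<close> near \<open>x\<close>, the point \<open>z + t d\<close> divides the segment from \<open>z\<close> to
  \<open>z + d\<close>. Paraconvexity therefore bounds the difference quotient by
  \<open>g (z + d) - g z + \<rho> \<parallel>d\<parallel>\<^bsup>1+\<nu>\<^esup>\<close>, uniformly in \<open>t\<close>. By continuity at both \<open>x\<close> and \<open>y\<close> this bound converges as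
  the base point \<open>z\<close> tends to \<open>x\<close>.\<close>

lemma clarke_subdiff_paraconvex_inequality:
  fixes f :: "'a::euclidean_space \<Rightarrow> ereal"
  assumes para: "paraconvex_on S \<nu> \<rho> f" "0 \<le> \<rho>" "0 \<le> \<nu>"
    and S: "open S" "convex S" and fg: "\<And>x. x \<in> S \<Longrightarrow> f x = ereal (g x)"
    and xy: "x \<in> S" "y \<in> S" and \<zeta>: "\<zeta> \<in> clarke_subdiff f x"
  shows "\<zeta> \<bullet> (y - x) \<le> g y - g x + \<rho> * norm (y - x) powr (1 + \<nu>)"
proof -
  define d where "d = y - x"
  define F where "F = nhds x \<times>\<^sub>F (at_right 0 :: real filter)"
  define h where "h = (\<lambda>p::'a \<times> real. g (fst p + d) - g (fst p) + \<rho> * norm d powr (1 + \<nu>))"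
  have F: "F \<noteq> bot" by (simp add: F_def prod_filter_eq_bot nhds_neq_bot)
  have para': "paraconvex_on S \<nu> \<rho> (\<lambda>x. ereal (g x))"
    using paraconvex_on_ereal_cong[OF para(1) S(2) fg] by simp
  have cont: "continuous_on S g"
    using paraconvex_on_continuous_on[OF para' para(2,3) S] .
  have lim1: "(g \<longlongrightarrow> g z) (nhds z)" if "z \<in> S" for z
    using cont S(1) that continuous_on_eq_continuous_at isCont_def tendsto_at_iff_tendsto_nhds by metis
  have fst_lim: "(fst \<longlongrightarrow> x) F"
    unfolding F_def by (rule filterlim_fst)
  have "((\<lambda>p. fst p + d) \<longlongrightarrow> x + d) F"
    by (intro tendsto_intros fst_lim)
  then have shift_lim: "((\<lambda>p. fst p + d) \<longlongrightarrow> y) F" by (simp add: d_def)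
  have "(h \<longlongrightarrow> g y - g x + \<rho> * norm d powr (1 + \<nu>)) F"
    unfolding h_def
    by (intro tendsto_intros filterlim_compose[OF lim1 shift_lim]
        filterlim_compose[OF lim1 fst_lim] xy)
  then have hlim: "((\<lambda>p. ereal (h p)) \<longlongrightarrow> ereal (g y - g x + \<rho> * norm d powr (1 + \<nu>))) F"
    by simp
  have ev1: "\<forall>\<^sub>F p in F. fst p \<in> S"
    using fst_lim S(1) xy(1) by (rule topological_tendstoD)
  have ev2: "\<forall>\<^sub>F p in F. fst p + d \<in> S"
    using shift_lim S(1) xy(2) by (rule topological_tendstoD)
  have "\<forall>\<^sub>F t in at_right (0::real). t \<in> {0<..<1}"
    by (rule eventually_at_right_real) simp
  then have ev3: "\<forall>\<^sub>F p in F. snd p \<in> {0<..<1}"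
    unfolding F_def by (rule eventually_compose_filterlim[OF _ filterlim_snd])
  have le: "\<forall>\<^sub>F p in F. (case p of (z, t) \<Rightarrow> (f (z + t *\<^sub>R d) - f z) / ereal t) \<le> ereal (h p)"
    using ev1 ev2 ev3
  proof eventually_elim
    case (elim p)
    obtain z t where p: "p = (z, t)" by force
    have t: "0 < t" "t < 1" and z: "z \<in> S" "z + d \<in> S" using elim p by auto
    have eq: "z + t *\<^sub>R d = t *\<^sub>R (z + d) + (1 - t) *\<^sub>R z"
      by (simp add: algebra_simps)
    have in_S: "z + t *\<^sub>R d \<in> S"
      unfolding eq using S(2) z t by (auto intro: convexD)
    have "g (z + t *\<^sub>R d) \<le> t * g (z + d) + (1 - t) * g z + \<rho> * t * norm (z + d - z) powr (1 + \<nu>)"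
      unfolding eq using z t para' para(2) by (intro paraconvex_onD[of S]) auto
    then have "g (z + t *\<^sub>R d) - g z \<le> t * h p"
      by (simp add: h_def p algebra_simps)
    then have "(g (z + t *\<^sub>R d) - g z) / t \<le> h p"
      using t by (simp add: field_simps)
    then show ?case using t by (simp add: p fg in_S z)
  qed
  have "ereal (\<zeta> \<bullet> d) \<le> clarke_dderiv f x d"
    using \<zeta> by (simp add: clarke_subdiff_def)
  also have "\<dots> \<le> Limsup F (\<lambda>p. ereal (h p))"
    unfolding clarke_dderiv_def F_def[symmetric] by (rule Limsup_mono[OF le])
  also have "\<dots> = ereal (g y - g x + \<rho> * norm d powr (1 + \<nu>))"
    by (rule lim_imp_Limsup[OF F hlim])
  finally show ?thesis by (simp add: d_def)
qed

section \<open>One projected subgradient step\<close>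

lemma minimizer_le:
  assumes "y \<in> minimizers f X" "x \<in> X"
  shows "f y \<le> f x"
  using assms unfolding minimizers_def is_arg_min_def by auto

lemma minimizers_in: "y \<in> minimizers f X \<Longrightarrow> y \<in> X"
  unfolding minimizers_def is_arg_min_def by auto

lemma closed_minimizers:
  fixes f :: "'a::topological_space \<Rightarrow> ereal"
  assumes "closed X" "continuous_on X g" "\<And>x. x \<in> X \<Longrightarrow> f x = ereal (g x)"
  shows "closed (minimizers f X)"
proof (cases "minimizers f X = {}")
  case False
  then obtain y where y: "y \<in> minimizers f X" by blast
  then have "y \<in> X" by (rule minimizers_in)
  have "minimizers f X = {x \<in> X. g x = g y}"
  proof (intro set_eqI iffI)
    fix x assume x: "x \<in> minimizers f X"
    then have "x \<in> X" by (rule minimizers_in)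
    moreover have "f x = f y"
      using minimizer_le[OF x \<open>y \<in> X\<close>] minimizer_le[OF y \<open>x \<in> X\<close>] by simp
    ultimately show "x \<in> {x \<in> X. g x = g y}" using assms(3) \<open>y \<in> X\<close> by simp
  next
    fix x assume x: "x \<in> {x \<in> X. g x = g y}"
    then have "f x = f y" using assms(3) \<open>y \<in> X\<close> by simp
    then show "x \<in> minimizers f X"
      using x minimizer_le[OF y] unfolding minimizers_def is_arg_min_def by (auto simp: not_less)
  qed
  then show ?thesis
    using continuous_closed_preimage_constant[OF assms(2,1), of "g y"] by simp
qed simp

text \<open>The infimum of \<open>f\<close> in the error bound is attained at \<open>y\<close>, so the bound becomes one on real values.\<close>

lemma holder_error_bound_minimizer:
  assumes "holder_error_bound f X \<mu> \<delta>" "y \<in> minimizers f X" "x \<in> X"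
    and "\<And>x. x \<in> X \<Longrightarrow> f x = ereal (g x)"
  shows "\<mu> * infdist x (minimizers f X) powr (1 / \<delta>) \<le> g x - g y"
proof -
  have y: "y \<in> X" using assms(2) by (rule minimizers_in)
  have "(INF z\<in>X. f z) = f y"
    using y minimizer_le[OF assms(2)] by (intro INF_eqI) auto
  then show ?thesis
    using assms(1,3) y assms(4) unfolding holder_error_bound_def by force
qed

text \<open>A feasible point \<open>y\<close> is its own projection, so projecting cannot increase the distance to \<open>y\<close>; what
  remains is the expansion of the squared norm after a step of length \<open>a\<close> along the unit vector
  \<open>-\<zeta> / \<parallel>\<zeta>\<parallel>\<close>.\<close>

lemma projected_unit_step_dist:
  fixes X :: "'a::euclidean_space set"
  assumes X: "closed X" "convex X" "y \<in> X"
    and \<zeta>: "\<zeta> \<noteq> 0" "norm \<zeta> \<le> L" and "0 \<le> a" "0 \<le> m" "m \<le> \<zeta> \<bullet> (x - y)"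
  shows "(dist (closest_point X (x - a *\<^sub>R (\<zeta> /\<^sub>R norm \<zeta>))) y)\<^sup>2 \<le> (dist x y)\<^sup>2 + a\<^sup>2 - 2 * a * (m / L)"
proof -
  define u where "u = \<zeta> /\<^sub>R norm \<zeta>"
  have u: "norm u = 1" using \<zeta> by (simp add: u_def)
  have "0 < norm \<zeta>" using \<zeta> by simp
  then have "m / L \<le> m / norm \<zeta>"
    using \<zeta> \<open>0 \<le> m\<close> \<open>0 < norm \<zeta>\<close>
    by (intro divide_left_mono mult_pos_pos) linarith+
  also have "\<dots> \<le> (\<zeta> \<bullet> (x - y)) / norm \<zeta>"
    using assms(8) by (intro divide_right_mono) auto
  also have "\<dots> = u \<bullet> (x - y)"
    by (simp add: u_def divide_inverse mult.commute)
  finally have mu: "2 * a * (m / L) \<le> 2 * a * (u \<bullet> (x - y))"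
    using \<open>0 \<le> a\<close> by (intro mult_left_mono) auto
  have "dist (closest_point X (x - a *\<^sub>R u)) (closest_point X y) \<le> dist (x - a *\<^sub>R u) y"
    using X by (intro closest_point_lipschitz) auto
  then have "(dist (closest_point X (x - a *\<^sub>R u)) y)\<^sup>2 \<le> (dist (x - a *\<^sub>R u) y)\<^sup>2"
    using X by (intro power_mono) (auto simp: closest_point_self)
  also have "dist (x - a *\<^sub>R u) y = norm ((x - y) - a *\<^sub>R u)"
    by (simp add: dist_norm algebra_simps)
  also have "(norm ((x - y) - a *\<^sub>R u))\<^sup>2 = (norm (x - y))\<^sup>2 + a\<^sup>2 * (norm u)\<^sup>2 - 2 * a * (u \<bullet> (x - y))"
    unfolding power2_norm_eq_inner
    by (simp add: inner_diff_left inner_diff_right inner_commute power2_eq_square)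
  also have "\<dots> \<le> (dist x y)\<^sup>2 + a\<^sup>2 - 2 * a * (m / L)"
    using mu u by (simp add: dist_norm)
  finally show ?thesis by (simp add: u_def)
qed

text \<open>Split \<open>d\<^bsup>1+\<nu>\<^esup> = d\<^bsup>e/\<delta>\<^esup> d\<^bsup>1/\<delta>\<^esup>\<close> with \<open>e = \<delta> (1 + \<nu>) - 1 > 0\<close>: the bound on \<open>d\<close> says precisely that the
  first factor is at most \<open>A\<close>. Applied with \<open>A = \<mu> / (2 \<rho>)\<close>, this makes the paraconvexity error at most
  half of the gain \<open>\<mu> d\<^bsup>1/\<delta>\<^esup>\<close> from the error bound.\<close>

lemma powr_error_absorbed:
  fixes d A \<nu> \<delta> :: real
  assumes "0 \<le> d" "0 < A" "0 < \<delta>" "0 < \<delta> * (1 + \<nu>) - 1"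
    and "d \<le> A powr (\<delta> / (\<delta> * (1 + \<nu>) - 1))"
  shows "d powr (1 + \<nu>) \<le> A * d powr (1 / \<delta>)"
proof -
  define e where "e = \<delta> * (1 + \<nu>) - 1"
  have e: "0 < e" using assms by (simp add: e_def)
  have "d powr (e / \<delta>) \<le> (A powr (\<delta> / e)) powr (e / \<delta>)"
    using assms e by (intro powr_mono2) (auto simp: e_def)
  also have "\<dots> = A" using assms e by (simp add: powr_powr)
  finally have "d powr (e / \<delta>) * d powr (1 / \<delta>) \<le> A * d powr (1 / \<delta>)"
    by (intro mult_right_mono) auto
  moreover have "e / \<delta> + 1 / \<delta> = 1 + \<nu>"
    using assms by (simp add: e_def field_simps)
  ultimately show ?thesis by (simp flip: powr_add)
qed

text \<open>The point \<open>y\<close> of reference is a minimizer nearest to \<open>x\<close>, which exists because the solution set, a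
  level set of a continuous function on a closed set, is closed. The lower bound
  \<open>\<zeta> \<bullet> (x - y) \<ge> (\<mu>/2) d\<^bsup>1/\<delta>\<^esup>\<close> also settles the exceptional case: \<open>\<zeta> = 0\<close> forces \<open>d = 0\<close>, and then the
  estimate holds although the iterate does not move.\<close>

lemma infdist_projected_subgradient_step:
  fixes f :: "'a::euclidean_space \<Rightarrow> ereal" and X :: "'a set"
  defines "M \<equiv> minimizers f X"
  assumes S: "open S" "convex S" "X \<subseteq> S"
    and fg: "\<And>x. x \<in> S \<Longrightarrow> f x = ereal (g x)"
    and para: "paraconvex_on S \<nu> \<rho> f" "0 < \<rho>" "0 \<le> \<nu>"
    and X: "closed X" "convex X" "M \<noteq> {}"
    and heb: "holder_error_bound f X \<mu> \<delta>" "0 < \<mu>" "0 < \<delta>" "0 < \<delta> * (1 + \<nu>) - 1"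
    and x: "x \<in> X" "infdist x M \<le> (\<mu> / (2 * \<rho>)) powr (\<delta> / (\<delta> * (1 + \<nu>) - 1))"
    and \<zeta>: "\<zeta> \<in> clarke_subdiff f x" "norm \<zeta> \<le> L" and "0 < L" "0 \<le> a"
    and x': "x' = (if \<zeta> = 0 then x else closest_point X (x - a *\<^sub>R (\<zeta> /\<^sub>R norm \<zeta>)))"
  shows "(infdist x' M)\<^sup>2 \<le> (infdist x M)\<^sup>2 + a\<^sup>2 - a * (\<mu> / L) * infdist x M powr (1 / \<delta>)"
proof -
  have "paraconvex_on S \<nu> \<rho> (\<lambda>x. ereal (g x))"
    using paraconvex_on_ereal_cong[OF para(1) S(2) fg] by simp
  then have "continuous_on X g"
    using paraconvex_on_continuous_on[of S \<nu> \<rho> g] para S continuous_on_subset by auto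
  then have "closed M"
    unfolding M_def using X(1) fg S(3) by (intro closed_minimizers) auto
  then obtain y where y: "y \<in> M" "infdist x M = dist x y"
    using X(3) by (rule infdist_attains_inf)
  have "y \<in> X" using y(1) unfolding M_def by (rule minimizers_in)
  define d where "d = infdist x M"
  define m where "m = \<mu> / 2 * d powr (1 / \<delta>)"
  have d: "0 \<le> d" "dist x y = d" by (simp_all add: d_def y infdist_nonneg)
  have m: "0 \<le> m" using heb by (simp add: m_def)
  have "\<zeta> \<bullet> (y - x) \<le> g y - g x + \<rho> * norm (y - x) powr (1 + \<nu>)"
    using S x(1) \<open>y \<in> X\<close> para \<zeta>(1) fg by (intro clarke_subdiff_paraconvex_inequality[of S \<nu> \<rho> f]) auto
  moreover have "norm (y - x) = d" using d by (simp add: dist_norm norm_minus_commute)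
  moreover have "\<mu> * d powr (1 / \<delta>) \<le> g x - g y"
    unfolding d_def M_def using heb(1) y(1) x(1) fg S(3)
    by (intro holder_error_bound_minimizer) (auto simp: M_def)
  moreover have "d powr (1 + \<nu>) \<le> \<mu> / (2 * \<rho>) * d powr (1 / \<delta>)"
    using d heb para x(2) by (intro powr_error_absorbed) (auto simp: d_def)
  then have "\<rho> * d powr (1 + \<nu>) \<le> m"
    using para(2) by (simp add: m_def field_simps)
  ultimately have "\<zeta> \<bullet> (y - x) \<le> - m" by (simp add: m_def)
  then have lower: "m \<le> \<zeta> \<bullet> (x - y)" by (simp add: inner_diff_right)
  have "(dist x' y)\<^sup>2 \<le> d\<^sup>2 + a\<^sup>2 - 2 * a * (m / L)"
  proof (cases "\<zeta> = 0")
    case True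
    then have "m = 0" using lower m by simp
    then show ?thesis using True d by (simp add: x')
  next
    case False
    then show ?thesis
      using projected_unit_step_dist[OF X(1,2) \<open>y \<in> X\<close> False \<zeta>(2) \<open>0 \<le> a\<close> m lower] d
      by (simp add: x')
  qed
  moreover have "(infdist x' M)\<^sup>2 \<le> (dist x' y)\<^sup>2"
    using infdist_le[OF y(1)] by (intro power_mono) (auto simp: infdist_nonneg)
  moreover have "2 * a * (m / L) = a * (\<mu> / L) * d powr (1 / \<delta>)"
    by (simp add: m_def)
  ultimately have "(infdist x' M)\<^sup>2 \<le> d\<^sup>2 + a\<^sup>2 - a * (\<mu> / L) * d powr (1 / \<delta>)"
    by linarith
  then show ?thesis by (simp only: d_def)
qed

section \<open>The scalar recursion\<close>

text \<open>The graph of the concave function \<open>t \<mapsto> t\<^sup>s\<close> lies below its tangent at \<open>a\<close>. Multiplied by \<open>a\<^bsup>1-s\<^esup>\<close> this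
  is Young's inequality for \<open>b\<^sup>s a\<^bsup>1-s\<^esup>\<close>.\<close>

lemma powr_diff_ge_tangent:
  fixes a b s :: real
  assumes "0 < a" "0 < b" "0 \<le> s" "s \<le> 1"
  shows "s * a powr (s - 1) * (a - b) \<le> a powr s - b powr s"
proof -
  have "b powr s = (b powr s * a powr (1 - s)) * a powr (s - 1)"
    using assms by (simp add: mult.assoc flip: powr_add)
  also have "\<dots> \<le> (s * b + (1 - s) * a) * a powr (s - 1)"
    using assms by (intro mult_right_mono Youngs_inequality_0) auto
  also have "\<dots> = a powr s - s * a powr (s - 1) * (a - b)"
    using assms powr_mult_base[of a "s - 1"] by (simp add: algebra_simps)
  finally show ?thesis by simp
qed

text \<open>Here \<open>E\<close> is the equilibrium, at which the gain \<open>c E\<^sup>s\<close> balances \<open>b\<close>. Above \<open>E\<close> the slope of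
  \<open>t \<mapsto> t\<^sup>s\<close> is at least its slope at the upper end \<open>R\<close>, since the slope decreases for \<open>s \<le> 1\<close>.\<close>

lemma sublinear_recursion_step:
  fixes D D' E R c s b :: real
  assumes "0 \<le> D" "D \<le> R" "0 < E" "0 \<le> c" "0 \<le> s" "s \<le> 1"
    and b: "b = c * E powr s" and step: "D' \<le> D + b - c * D powr s"
  shows "E \<le> D \<Longrightarrow> D' - E \<le> (1 - c * (s * R powr (s - 1))) * (D - E)"
    and "D \<le> E \<Longrightarrow> D' \<le> E + b"
proof -
  assume "E \<le> D"
  have "s * R powr (s - 1) * (D - E) \<le> s * D powr (s - 1) * (D - E)"
    using assms \<open>E \<le> D\<close> by (intro mult_right_mono mult_left_mono powr_mono2') auto
  also have "\<dots> \<le> D powr s - E powr s"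
    using assms \<open>E \<le> D\<close> by (intro powr_diff_ge_tangent) auto
  finally have "c * (s * R powr (s - 1) * (D - E)) \<le> c * (D powr s - E powr s)"
    using assms by (intro mult_left_mono) auto
  then show "D' - E \<le> (1 - c * (s * R powr (s - 1))) * (D - E)"
    using step b by (simp add: algebra_simps)
next
  assume "D \<le> E"
  moreover have "0 \<le> c * D powr s" using assms by simp
  ultimately show "D' \<le> E + b" using step by linarith
qed

text \<open>The two conclusions are proved together, because the recursion is available only while \<open>D\<close> stays below
  \<open>R\<close>, which the first of them ensures. Above \<open>E\<close> the distance to \<open>E\<close> contracts, so neither bound is
  lost; below \<open>E\<close> the next value is at most \<open>E + b\<close>, which both bounds allow. Since \<open>q \<le> 1\<close>, contraction
  after an overshoot keeps \<open>D - E\<close> below \<open>b\<close>.\<close>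

lemma sublinear_recursion_bound:
  fixes D :: "nat \<Rightarrow> real" and E R c s b q :: real
  assumes "\<And>k. 0 \<le> D k" "0 < E" "0 \<le> c" "0 \<le> s" "s \<le> 1"
    and b: "b = c * E powr s" and R: "max (D 0) (b + E) \<le> R"
    and step: "\<And>k. (\<And>j. j \<le> k \<Longrightarrow> D j \<le> R) \<Longrightarrow> D (Suc k) \<le> D k + b - c * D k powr s"
    and q: "q = 1 - c * (s * R powr (s - 1))" "0 \<le> q" "q \<le> 1"
  shows "D k \<le> max (D 0) (b + E) \<and> D k - E \<le> max (q ^ k * (D 0 - E)) b"
proof (induction k rule: less_induct)
  case (less k)
  have b0: "0 \<le> b" using assms(3) by (simp add: b)
  show ?case
  proof (cases k)
    case (Suc n)
    have IH: "D n \<le> max (D 0) (b + E)" "D n - E \<le> max (q ^ n * (D 0 - E)) b"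
      using less[of n] Suc by auto
    have DR: "D j \<le> R" if "j \<le> n" for j
      using less[of j] that Suc R by auto
    note one = sublinear_recursion_step[OF assms(1) DR[OF order_refl] assms(2-5) b step[OF DR]]
    show ?thesis
    proof (cases "E \<le> D n")
      case True
      have D': "D (Suc n) - E \<le> q * (D n - E)" using one(1) True by (simp add: q(1))
      also have "\<dots> \<le> q * max (q ^ n * (D 0 - E)) b"
        using IH(2) q(2) by (rule mult_left_mono)
      also have "\<dots> = max (q ^ Suc n * (D 0 - E)) (q * b)"
        using q(2) by (simp add: max_mult_distrib_left mult.assoc)
      also have "\<dots> \<le> max (q ^ Suc n * (D 0 - E)) b"
        using mult_left_le_one_le[OF b0 q(2,3)] by auto
      finally have "D (Suc n) - E \<le> max (q ^ Suc n * (D 0 - E)) b" .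
      moreover
      have "q * (D n - E) \<le> D n - E"
        using True q by (intro mult_left_le_one_le) auto
      then have "D (Suc n) \<le> max (D 0) (b + E)" using D' IH(1) by linarith
      ultimately show ?thesis using Suc by simp
    next
      case False
      then show ?thesis using one(2) Suc by auto
    qed
  qed auto
qed

section \<open>Linear convergence up to the step-size\<close>

theorem theorem4p3:
  fixes f :: "real ^ 'n \<Rightarrow> ereal"
    and X X' :: "(real ^ 'n) set"
    and \<rho> \<nu> \<delta> \<mu> L \<tau> \<alpha> Dstar q \<D> :: real
    and x :: "nat \<Rightarrow> real ^ 'n"
    and D :: "nat \<Rightarrow> real"
  assumes "proper_fun f"
    and "X \<subseteq> effective_dom f" and "X \<noteq> {}" and "closed X" and "convex X"
    and "minimizers f X \<noteq> {}"
    and "0 < \<rho>" and "0 < \<nu>" and "\<nu> \<le> 1" and "1 / (1 + \<nu>) < \<delta>" and "\<delta> \<le> 1" and "0 < \<mu>"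
    and "open X'" and "convex X'" and "X \<subseteq> X'" and "X' \<subseteq> effective_dom f"
    and "paraconvex_on X' \<nu> \<rho> f"
    and "holder_error_bound f X \<mu> \<delta>"
    and "ereal L = (SUP \<zeta>\<in>(\<Union>z\<in>tube f X \<nu> \<rho> \<mu> \<delta> 1. clarke_subdiff f z). ereal (norm \<zeta>))"
    and "0 < L"
    and "\<tau> = \<mu> / L"
    and "0 < \<alpha>"
    and "\<alpha> < Min {2 * \<delta> / \<tau> * (\<mu> / (2 * \<rho>)) powr ((2 * \<delta> - 1) / (\<delta> * (1 + \<nu>) - 1)),
                  \<tau> / (\<tau> powr (2 * \<delta>) + 1) powr (1 / (2 * \<delta>))
                    * (\<mu> / (2 * \<rho>)) powr (1 / (\<delta> * (1 + \<nu>) - 1)),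
                  1}"
    and "x 0 \<in> tube f X \<nu> \<rho> \<mu> \<delta> (1 / 2)"
    and "proj_subgradient_seq f X (\<lambda>_. \<alpha>) x"
    and "\<And>k. D k = (infdist (x k) (minimizers f X))\<^sup>2"
    and "Dstar = (\<alpha> / \<tau>) powr (2 * \<delta>)"
    and "q = 1 - \<alpha> * \<tau> / (2 * \<delta>)
               * (2 * \<rho> / \<mu>) powr ((2 * \<delta> - 1) / (\<delta> * (1 + \<nu>) - 1))"
    and "0 \<le> \<D>" and "\<D>\<^sup>2 = max (D 0) (\<alpha>\<^sup>2 + Dstar)"
  shows "0 < q \<and> q < 1 \<and>
    (\<forall>k. sqrt (D k) \<le> \<D> \<and>
         \<D> \<le> (\<mu> / (2 * \<rho>)) powr (\<delta> / (\<delta> * (1 + \<nu>) - 1)) \<and>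
         D k - Dstar \<le> max (q ^ k * (D 0 - Dstar)) (\<alpha>\<^sup>2))"
proof -
  define g where "g z = real_of_ereal (f z)" for z
  define M where "M = minimizers f X"
  define e where "e = \<delta> * (1 + \<nu>) - 1"
  define A where "A = \<mu> / (2 * \<rho>)"
  define R where "R = A powr (\<delta> / e)"
  define s where "s = 1 / (2 * \<delta>)"
  have fg: "f z = ereal (g z)" if "z \<in> X'" for z
  proof -
    have "f z < \<infinity>" "f z \<noteq> - \<infinity>"
      using that assms(1,16) by (auto simp: proper_fun_def effective_dom_def)
    then show ?thesis by (cases "f z") (auto simp: g_def)
  qed
  have e: "0 < e" using assms(8,10) by (simp add: e_def field_simps)
  have "1 / 2 \<le> 1 / (1 + \<nu>)" using assms(8,9) by (intro divide_left_mono) auto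
  then have \<delta>: "1 / 2 < \<delta>" using assms(10) by linarith
  have s: "0 < s" "s \<le> 1" "2 * \<delta> * s = 1" using \<delta> by (auto simp: s_def field_simps)
  have pos: "0 < A" "0 < \<tau>" "0 < R" using assms(7,12,20,21) by (auto simp: A_def R_def)
  have \<alpha>1: "\<alpha> < 2 * \<delta> / \<tau> * A powr ((2 * \<delta> - 1) / e)"
    and \<alpha>2: "\<alpha> < \<tau> / (\<tau> powr (2 * \<delta>) + 1) powr (1 / (2 * \<delta>)) * A powr (1 / e)"
    and \<alpha>3: "\<alpha> < 1"
    using assms(23) by (auto simp: A_def e_def)
  have q_eq: "q = 1 - \<alpha> * \<tau> / (2 * \<delta>) / A powr ((2 * \<delta> - 1) / e)"
  proof -
    have "(2 * \<rho> / \<mu>) powr ((2 * \<delta> - 1) / e) = 1 / A powr ((2 * \<delta> - 1) / e)"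
      unfolding A_def using assms(7,12) by (subst (1 2) powr_divide) auto
    then show ?thesis unfolding assms(28) e_def by simp
  qed
  have "0 < \<alpha> * \<tau> / (2 * \<delta>) / A powr ((2 * \<delta> - 1) / e)"
    using pos assms(22) \<delta> by simp
  moreover have "\<alpha> * \<tau> / (2 * \<delta>) / A powr ((2 * \<delta> - 1) / e) < 1"
    using \<alpha>1 pos \<delta> by (simp add: field_simps)
  ultimately have q: "0 < q" "q < 1" unfolding q_eq by auto
  \<comment> \<open>the slope factor at \<open>R\<^sup>2\<close>, which identifies \<open>q\<close> as the contraction factor of the recursion\<close>
  have R2_powr: "(R\<^sup>2) powr (s - 1) = 1 / A powr ((2 * \<delta> - 1) / e)"
  proof -
    have "R\<^sup>2 = A powr (2 * \<delta> / e)"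
      by (simp add: R_def power2_eq_square flip: powr_add)
    moreover have "2 * \<delta> / e * (s - 1) = - ((2 * \<delta> - 1) / e)"
      using s(3) e by (simp add: field_simps)
    ultimately show ?thesis by (simp add: powr_powr powr_minus divide_inverse)
  qed
  have q_R: "q = 1 - \<alpha> * \<tau> * (s * (R\<^sup>2) powr (s - 1))"
    unfolding R2_powr q_eq by (simp add: s_def)
  have Dstar: "0 < Dstar" "Dstar powr s = \<alpha> / \<tau>"
    using pos assms(22) s(3) by (auto simp: assms(27) powr_powr)
  have \<alpha>_sq: "\<alpha>\<^sup>2 = \<alpha> * \<tau> * Dstar powr s"
    using pos by (simp add: Dstar power2_eq_square)
  have "\<alpha>\<^sup>2 + Dstar \<le> R\<^sup>2"
  proof -
    let ?T = "\<tau> powr (2 * \<delta>)"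
    \<comment> \<open>\<open>\<alpha> < 1\<close> and \<open>\<delta> \<le> 1\<close> turn \<open>\<alpha>\<^sup>2\<close> into the same power of \<open>\<alpha>\<close> as in \<open>Dstar\<close>\<close>
    have "\<alpha>\<^sup>2 = \<alpha> powr 2" using assms(22) by simp
    also have "\<dots> \<le> \<alpha> powr (2 * \<delta>)" using \<alpha>3 assms(11,22) by (intro powr_mono') auto
    finally have "\<alpha>\<^sup>2 + Dstar \<le> \<alpha> powr (2 * \<delta>) * (?T + 1) / ?T"
      using pos assms(22) by (simp add: assms(27) powr_divide field_simps)
    also have "\<dots> \<le> (\<tau> / (?T + 1) powr (1 / (2 * \<delta>)) * A powr (1 / e)) powr (2 * \<delta>) * (?T + 1) / ?T"
      using \<alpha>2 assms(22) \<delta> pos by (intro divide_right_mono mult_right_mono powr_mono2) auto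
    also have "\<dots> = A powr (2 * \<delta> / e)"
    proof -
      have "(\<tau> / (?T + 1) powr (1 / (2 * \<delta>)) * A powr (1 / e)) powr (2 * \<delta>)
          = ?T / (?T + 1) * A powr (2 * \<delta> / e)"
        using pos \<delta> by (simp add: powr_mult powr_divide powr_powr add_nonneg_nonneg)
      moreover have "0 < ?T" "0 < ?T + 1" using pos by (auto intro: add_pos_pos)
      ultimately show ?thesis by (simp add: field_simps)
    qed
    also have "\<dots> = R\<^sup>2" by (simp add: R_def power2_eq_square flip: powr_add)
    finally show ?thesis .
  qed
  moreover have x0: "x 0 \<in> X" "infdist (x 0) M < R"
    using assms(24) by (auto simp: tube_def M_def R_def A_def e_def)
  have "D 0 \<le> R\<^sup>2"
    using x0(2) by (simp add: assms(26) flip: M_def) (simp add: infdist_nonneg power_mono)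
  ultimately have R: "max (D 0) (\<alpha>\<^sup>2 + Dstar) \<le> R\<^sup>2" by simp
  obtain \<zeta> where \<zeta>: "\<And>k. \<zeta> k \<in> clarke_subdiff f (x k)"
    and iter: "\<And>k. x (Suc k) = (if \<zeta> k = 0 then x k
        else closest_point X (x k - \<alpha> *\<^sub>R (\<zeta> k /\<^sub>R norm (\<zeta> k))))"
    using assms(25) unfolding proj_subgradient_seq_def by metis
  have inX: "x k \<in> X" for k
    by (induction k) (auto simp: x0 iter closest_point_in_set assms(3,4))
  \<comment> \<open>\<open>R\<close> is smaller than the radius of the tube over which \<open>L\<close> is the supremum\<close>
  have "R < (1 * \<mu> / \<rho>) powr (\<delta> / e)"
    unfolding R_def A_def using assms(7,12) \<delta> e by (intro powr_less_mono2) (auto simp: field_simps)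
  then have normL: "norm (\<zeta> k) \<le> L" if "infdist (x k) M \<le> R" for k
  proof -
    have "x k \<in> tube f X \<nu> \<rho> \<mu> \<delta> 1"
      using that inX \<open>R < _\<close> by (auto simp: tube_def M_def e_def)
    then have "ereal (norm (\<zeta> k)) \<le> ereal L"
      unfolding assms(19) using \<zeta> by (intro SUP_upper) auto
    then show ?thesis by simp
  qed
  have step: "D (Suc k) \<le> D k + \<alpha>\<^sup>2 - \<alpha> * \<tau> * D k powr s" if "D k \<le> R\<^sup>2" for k
  proof -
    have dR: "infdist (x k) M \<le> R"
      using that pos by (simp add: assms(26) M_def power2_le_iff_abs_le infdist_nonneg)
    have "D k powr s = infdist (x k) M powr (1 / \<delta>)"
    proof (cases "infdist (x k) M = 0")
      case False
      then have "0 < infdist (x k) M" using infdist_nonneg[of "x k" M] by linarith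
      then have "D k = infdist (x k) M powr 2" by (simp add: assms(26) M_def)
      then show ?thesis by (simp add: powr_powr s_def)
    qed (simp add: assms(26) M_def)
    moreover have "(infdist (x (Suc k)) M)\<^sup>2
        \<le> (infdist (x k) M)\<^sup>2 + \<alpha>\<^sup>2 - \<alpha> * (\<mu> / L) * infdist (x k) M powr (1 / \<delta>)"
      unfolding M_def
      by (rule infdist_projected_subgradient_step[OF assms(13-15) fg assms(17,7) _ assms(4,5,6,18,12)
            _ _ inX _ \<zeta> normL assms(20) _ iter])
        (use assms(8,22) \<delta> e dR in \<open>auto simp: e_def M_def R_def A_def\<close>)
    ultimately show ?thesis by (simp add: assms(21,26) M_def)
  qed
  have main: "D k \<le> max (D 0) (\<alpha>\<^sup>2 + Dstar) \<and> D k - Dstar \<le> max (q ^ k * (D 0 - Dstar)) (\<alpha>\<^sup>2)" for k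
    by (rule sublinear_recursion_bound[where R = "R\<^sup>2" and c = "\<alpha> * \<tau>" and s = s])
      (use step s q pos assms(22) Dstar(1) \<alpha>_sq R q_R in \<open>auto simp: assms(26)\<close>)
  have "sqrt (D k) \<le> \<D>" for k
    using main[of k] assms(29,30) by (intro real_le_lsqrt) auto
  moreover have "\<D> \<le> R"
    using R pos(3) assms(30) by (intro power2_le_imp_le[of \<D> R]) auto
  ultimately show ?thesis
    using main q by (simp add: R_def A_def e_def)
qed

end
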